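(* Let $b\ge2$ be an integer and $c\ge2$ real, $\alpha=\log_b c$, $\rho=\{\alpha\}$, with $\rho$ irrational. Let $q_{k-1}<q_k$, $q_k\ge2$, be adjacent denominators of regular continued-fraction convergents of $\rho$, and put $d_k=\|q_{k-1}\rho\|$. Let $M,H\ge1$ be integers, put $t_H=\log_b\frac{M+H+1}{M+1}$, and suppose $$H\le q_k,\qquad t_H\le\frac{d_k}{2}.$$ (A convenient sufficient condition for this is $H\le q_k$ and $M\ge\frac{q_k}{b^{d_k/2}-1}-1$.) Let $\theta=\{M\alpha-\log_b(M+1)\}$. Choose an integer $Q$ with $$Q>16(H+3)(q_k+q_{k-1})$$ and let $B,P$ be nearest-integer roundings of $Q\theta$ and $Q\rho$ respectively (ties settled by either fixed convention), so that $$\mathrm{dist}_{\mathbb T}\left(\theta,\frac BQ\right)\le\frac1{2Q},\qquad\left|\rho-\frac PQ\right|\le\frac1{2Q}.$$ Round the two endpoints of $$\left[-\frac{H+1}{Q},\,t_H+\frac{H+1}{Q}\right]\pmod1$$ outward to the $Q^{-1}$ grid, each endpoint being moved outward by less than $3/Q$, and denote by $\mathcal J_Q\subset\mathbb T$ the resulting union of at most two circular intervals with endpoints on the $Q^{-1}$ grid. Then $$\mathcal R(M,H)=\left\{1\le j\le H:\frac{(B+Pj)\bmod Q}{Q}\in\mathcal J_Q\right\}$$ contains every $j\in\{1,\dots,H\}$ with $M+j\in\mathcal S_{c,b}$ (every genuine solution in $(M,M+H]$) and has cardinality at most one. It can be reported in $O(\log H\log Q)$ multi-precision integer arithmetic steps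 by Euclidean floor sums and binary search.
   Context: $\mathcal S_{c,b}$ is the set of integers $m\ge1$ for which there is an integer $k\ge0$ with $mb^k\le c^m<(m+1)b^k$. $\{x\}=x-\lfloor x\rfloor$, $\|x\|$ is the distance from $x$ to the nearest integer, $\mathbb T=\mathbb R/\mathbb Z$ with circular distance $\mathrm{dist}_{\mathbb T}$. The outward rounding is to be performed from certified interval enclosures of the true endpoints (with at most $2/Q$ expansion past the certified enclosure, hence less than $3/Q$ relative to the true endpoint), so $\mathcal J_Q$ contains the true arc. In the step count each multi-precision integer operation counts as one arithmetic step, and $B,P,Q$ and $\mathcal J_Q$ are given. The Euclidean floor-sum algorithm evaluates $\sum_{0\le j<n}\lfloor(Pj+B)/Q\rfloor$. *)

theory Defs
  imports "HOL-Analysis.Analysis"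
begin

definition sol_set :: "real \<Rightarrow> nat \<Rightarrow> nat set" where
  "sol_set c b = {m. 1 \<le> m \<and> (\<exists>k::nat. real m * real b ^ k \<le> c ^ m \<and> c ^ m < real (m + 1) * real b ^ k)}"

definition int_dist :: "real \<Rightarrow> real" where
  "int_dist x = \<bar>x - of_int (round x)\<bar>"

text \<open>
  A point of the circle is represented by any real number in its class modulo 1,
  and a subset of the circle by the set of its representatives in the interval from 0
  (included) to 1 (excluded).
\<close>

definition circ_dist :: "real \<Rightarrow> real \<Rightarrow> real" where
  "circ_dist x y = int_dist (x - y)"

definition circ_arc :: "real \<Rightarrow> real \<Rightarrow> real set" where
  "circ_arc x y = frac ` {x..y}"

text \<open>
  Regular continued fraction of an irrational number: complete quotients, partial
  quotients, and denominators of the convergents, the first of which is the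
  denominator 1 of the integer part.
\<close>

fun cf_complete :: "real \<Rightarrow> nat \<Rightarrow> real" where
  "cf_complete x 0 = x"
| "cf_complete x (Suc n) = 1 / frac (cf_complete x n)"

definition cf_quot :: "real \<Rightarrow> nat \<Rightarrow> int" where
  "cf_quot x n = \<lfloor>cf_complete x n\<rfloor>"

fun cf_denom :: "real \<Rightarrow> nat \<Rightarrow> int" where
  "cf_denom x 0 = 1"
| "cf_denom x (Suc 0) = cf_quot x 1"
| "cf_denom x (Suc (Suc n)) = cf_quot x (Suc (Suc n)) * cf_denom x (Suc n) + cf_denom x n"

text \<open>A nearest integer; both choices are allowed in case of a tie.\<close>

definition is_nearest_int :: "int \<Rightarrow> real \<Rightarrow> bool" where
  "is_nearest_int n x \<longleftrightarrow> (\<forall>m::int. \<bar>x - of_int n\<bar> \<le> \<bar>x - of_int m\<bar>)"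

text \<open>
  The two ends of an interval are moved outward to grid points \<open>l / Q\<close> and \<open>u / Q\<close>, each by
  less than \<open>3 / Q\<close>.
\<close>

definition outward_rounding :: "int \<Rightarrow> real \<Rightarrow> real \<Rightarrow> int \<Rightarrow> int \<Rightarrow> bool" where
  "outward_rounding Q x y l u \<longleftrightarrow>
     of_int l / of_int Q \<le> x \<and> x - of_int l / of_int Q < 3 / of_int Q \<and>
     y \<le> of_int u / of_int Q \<and> of_int u / of_int Q - y < 3 / of_int Q"

definition candidates :: "int \<Rightarrow> int \<Rightarrow> int \<Rightarrow> real set \<Rightarrow> nat \<Rightarrow> nat set" where
  "candidates Q B P J H = {j. 1 \<le> j \<and> j \<le> H \<and> of_int ((B + P * int j) mod Q) / of_int Q \<in> J}"

text \<open>
  A while language over unbounded integers. Every arithmetic operation, every comparison and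
  every assignment is one step, whatever the size of the operands.
\<close>

type_synonym vname = string
type_synonym state = "vname \<Rightarrow> int"

datatype aexp =
    N int
  | V vname
  | Add aexp aexp (infixl "\<oplus>" 65)
  | Sub aexp aexp (infixl "\<ominus>" 65)
  | Mul aexp aexp (infixl "\<otimes>" 70)
  | Div aexp aexp (infixl "DIV" 70)
  | Mod aexp aexp (infixl "MOD" 70)

datatype bexp = Less aexp aexp (infix "LESS" 50)

datatype com =
    Assign vname aexp ("_ ::= _" [1000, 61] 61)
  | Seq com com ("_;;/ _" [60, 61] 60)
  | Cond bexp com com ("(IF _/ THEN _/ ELSE _)" [0, 0, 61] 61)
  | While bexp com ("(WHILE _/ DO _)" [0, 61] 61)

fun aval :: "aexp \<Rightarrow> state \<Rightarrow> int" where
  "aval (N i) s = i"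
| "aval (V x) s = s x"
| "aval (e \<oplus> f) s = aval e s + aval f s"
| "aval (e \<ominus> f) s = aval e s - aval f s"
| "aval (e \<otimes> f) s = aval e s * aval f s"
| "aval (e DIV f) s = aval e s div aval f s"
| "aval (e MOD f) s = aval e s mod aval f s"

fun acost :: "aexp \<Rightarrow> nat" where
  "acost (N i) = 0"
| "acost (V x) = 0"
| "acost (e \<oplus> f) = acost e + acost f + 1"
| "acost (e \<ominus> f) = acost e + acost f + 1"
| "acost (e \<otimes> f) = acost e + acost f + 1"
| "acost (e DIV f) = acost e + acost f + 1"
| "acost (e MOD f) = acost e + acost f + 1"

fun bval :: "bexp \<Rightarrow> state \<Rightarrow> bool" where
  "bval (e LESS f) s \<longleftrightarrow> aval e s < aval f s"

fun bcost :: "bexp \<Rightarrow> nat" where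
  "bcost (e LESS f) = acost e + acost f + 1"

text \<open>\<open>exec p s n t\<close>: started in state \<open>s\<close>, program \<open>p\<close> halts in state \<open>t\<close> after \<open>n\<close> steps.\<close>

inductive exec :: "com \<Rightarrow> state \<Rightarrow> nat \<Rightarrow> state \<Rightarrow> bool" where
  Assign: "exec (x ::= e) s (acost e + 1) (s(x := aval e s))"
| Seq: "exec p s m t \<Longrightarrow> exec q t n r \<Longrightarrow> exec (p;; q) s (m + n) r"
| IfTrue: "bval e s \<Longrightarrow> exec p s n t \<Longrightarrow> exec (IF e THEN p ELSE q) s (bcost e + n) t"
| IfFalse: "\<not> bval e s \<Longrightarrow> exec q s n t \<Longrightarrow> exec (IF e THEN p ELSE q) s (bcost e + n) t"
| WhileFalse: "\<not> bval e s \<Longrightarrow> exec (WHILE e DO p) s (bcost e) s"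
| WhileTrue: "bval e s \<Longrightarrow> exec p s m t \<Longrightarrow> exec (WHILE e DO p) t n r \<Longrightarrow>
    exec (WHILE e DO p) s (bcost e + m + n) r"

inductive_cases exec_AssignE: "exec (x ::= e) s n t"
inductive_cases exec_SeqE: "exec (p;; q) s n t"
inductive_cases exec_CondE: "exec (IF e THEN p ELSE q) s n t"
inductive_cases exec_WhileE: "exec (WHILE e DO p) s n t"

lemma exec_deterministic: "exec p s n t \<Longrightarrow> exec p s n' t' \<Longrightarrow> n' = n \<and> t' = t"
proof (induction arbitrary: n' t' rule: exec.induct)
  case (Assign x e s)
  from Assign.prems show ?case by (rule exec_AssignE) simp
next
  case (Seq p s m t q n r)
  from Seq.prems show ?case by (rule exec_SeqE) (metis Seq.IH)
next
  case (IfTrue e s p n t q)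
  from IfTrue.prems show ?case by (rule exec_CondE) (metis IfTrue.IH IfTrue.hyps(1))+
next
  case (IfFalse e s q n t p)
  from IfFalse.prems show ?case by (rule exec_CondE) (metis IfFalse.IH IfFalse.hyps(1))+
next
  case (WhileFalse e s p)
  from WhileFalse.prems show ?case by (rule exec_WhileE) (metis WhileFalse.hyps(1))+
next
  case (WhileTrue e s p m t n r)
  from WhileTrue.prems show ?case by (rule exec_WhileE) (metis WhileTrue.IH WhileTrue.hyps(1))+
qed

text \<open>
  Euclidean floor sum: sets \<open>r\<close> to the sum of \<open>\<lfloor>(a * j + b) / m\<rfloor>\<close> over \<open>0 \<le> j < n\<close>, for
  \<open>n, a \<ge> 0\<close> and \<open>m > 0\<close>. After \<open>a\<close> and \<open>b\<close> have been reduced modulo \<open>m\<close>, the remaining sum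
  counts the lattice points under a line; exchanging the two axes exchanges \<open>a\<close> and \<open>m\<close>.
\<close>

definition floor_sum_prog :: com where
  "floor_sum_prog =
     (''r'' ::= N 0;;
      WHILE N 0 LESS V ''n'' DO (
        ''r'' ::= V ''r'' \<oplus> (V ''n'' \<otimes> (V ''n'' \<ominus> N 1) DIV N 2) \<otimes> (V ''a'' DIV V ''m'')
                       \<oplus> V ''n'' \<otimes> (V ''b'' DIV V ''m'');;
        ''a'' ::= V ''a'' MOD V ''m'';;
        ''b'' ::= V ''b'' MOD V ''m'';;
        ''y'' ::= V ''a'' \<otimes> V ''n'' \<oplus> V ''b'';;
        ''n'' ::= V ''y'' DIV V ''m'';;
        ''b'' ::= V ''y'' MOD V ''m'';;
        ''t'' ::= V ''m'';;
        ''m'' ::= V ''a'';;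
        ''a'' ::= V ''t''))"

text \<open>
  Sets \<open>cnt\<close> to the number of indices \<open>1 \<le> j \<le> w\<close> such that \<open>B + P * j\<close> is congruent modulo
  \<open>Q\<close> to one of the integers from \<open>l\<close> to \<open>u\<close>, provided that \<open>0 \<le> u - l < Q\<close>: for each \<open>j\<close>
  the difference \<open>\<lfloor>(B + P * j - l) / Q\<rfloor> - \<lfloor>(B + P * j - u - 1) / Q\<rfloor>\<close> is 1 or 0 accordingly.
\<close>

definition count_prog :: com where
  "count_prog =
     (''n'' ::= V ''w'';; ''a'' ::= V ''P'';; ''m'' ::= V ''Q'';;
      ''b'' ::= V ''B'' \<oplus> V ''P'' \<ominus> V ''l'';;
      floor_sum_prog;;
      ''cnt'' ::= V ''r'';;
      ''n'' ::= V ''w'';; ''a'' ::= V ''P'';; ''m'' ::= V ''Q'';;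
      ''b'' ::= V ''B'' \<oplus> V ''P'' \<ominus> V ''u'' \<ominus> N 1;;
      floor_sum_prog;;
      ''cnt'' ::= V ''cnt'' \<ominus> V ''r'')"

text \<open>
  Binary search for the first counted index in the range from 1 to \<open>H\<close>; the answer 0 in
  \<open>out\<close> means that there is none.
\<close>

definition report_prog :: com where
  "report_prog =
     (''w'' ::= V ''H'';;
      count_prog;;
      IF V ''cnt'' LESS N 1 THEN ''out'' ::= N 0
      ELSE (
        ''lo'' ::= N 0;;
        ''hi'' ::= V ''H'';;
        WHILE V ''lo'' \<oplus> N 1 LESS V ''hi'' DO (
          ''w'' ::= (V ''lo'' \<oplus> V ''hi'') DIV N 2;;
          count_prog;;
          IF V ''cnt'' LESS N 1 THEN ''lo'' ::= V ''w'' ELSE ''hi'' ::= V ''w'');;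
        ''out'' ::= V ''hi''))"

end

theory Submission
  imports Defs
begin

text \<open>
  Write \<open>m = M + j\<close>. Taking logarithms in \<open>m b\<^sup>k \<le> c\<^sup>m < (m + 1) b\<^sup>k\<close> and subtracting
  \<open>log\<^sub>b (M + 1)\<close> shows that a solution \<open>m\<close> in \<open>(M, M + H]\<close> makes the point \<open>\<theta> + j \<rho>\<close> of a circle
  rotation fall into the short arc \<open>[0, t]\<close> modulo 1 (\<open>sol_set_rotation\<close>). Replacing \<open>\<theta>\<close> and \<open>\<rho>\<close>
  by the grid points \<open>B / Q\<close> and \<open>P / Q\<close> moves this point by at most \<open>(H + 1) / (2 Q)\<close>, which the
  enlargement of the arc absorbs; so no solution is lost (\<open>solution_is_candidate\<close>).

  Conversely, if \<open>i < j\<close> were both candidates, then \<open>h = j - i\<close> would satisfy \<open>1 \<le> h < q\<^sub>k\<close>, and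
  \<open>h \<rho>\<close> would be closer to an integer than \<open>t\<close> plus an error of at most \<open>(5 H / 2 + 8) / Q\<close>. The
  law of best approximation says that \<open>h \<rho>\<close> is at least \<open>d\<close> away from every integer
  (\<open>int_dist_convergent_le\<close>), and \<open>d \<ge> 1 / (q\<^sub>k + q\<^sub>k\<^sub>-\<^sub>1)\<close> (\<open>int_dist_convergent_ge\<close>), so the lower
  bound on \<open>Q\<close> makes the error smaller than \<open>d / 2\<close>. With \<open>t \<le> d / 2\<close> this is absurd
  (\<open>candidates_at_most_one\<close>).

  Being a candidate is a condition on the residue of \<open>B + P j\<close> modulo \<open>Q\<close>, and the number of
  \<open>j \<le> w\<close> that satisfy it is a difference of two floor sums (\<open>card_hits\<close>). A floor sum is computed
  by Euclid's algorithm: reducing the coefficients modulo \<open>m\<close> and then counting the same lattice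
  points along the other axis replaces \<open>(a, m)\<close> by \<open>(m, a mod m)\<close>. Each round at least halves
  \<open>m * (a mod m)\<close>, so there are \<open>O(log Q)\<close> rounds (\<open>runs_floor_sum_loop\<close>). Bisection on \<open>w\<close> needs
  \<open>O(log H)\<close> such counts to locate the least candidate, which is the only one
  (\<open>runs_report_prog\<close>, \<open>report_prog_reports\<close>).
\<close>

section \<open>Convergents\<close>

fun cf_numer :: "real \<Rightarrow> nat \<Rightarrow> int" where
  "cf_numer x 0 = cf_quot x 0"
| "cf_numer x (Suc 0) = cf_quot x 1 * cf_quot x 0 + 1"
| "cf_numer x (Suc (Suc n)) = cf_quot x (Suc (Suc n)) * cf_numer x (Suc n) + cf_numer x n"

definition cf_error :: "real \<Rightarrow> nat \<Rightarrow> real" where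
  "cf_error x n = of_int (cf_denom x n) * x - of_int (cf_numer x n)"

lemma frac_irrational:
  assumes "x \<notin> \<rat>"
  shows "frac x \<notin> \<rat>"
proof
  assume "frac x \<in> \<rat>"
  then have "frac x + of_int \<lfloor>x\<rfloor> \<in> \<rat>" by simp
  then show False using assms by (simp add: frac_def)
qed

lemma cf_complete_irrational:
  assumes "x \<notin> \<rat>"
  shows "cf_complete x n \<notin> \<rat>"
proof (induction n)
  case 0
  then show ?case using assms by simp
next
  case (Suc n)
  show ?case
  proof
    assume "cf_complete x (Suc n) \<in> \<rat>"
    then have "inverse (1 / frac (cf_complete x n)) \<in> \<rat>" by (metis Rats_inverse cf_complete.simps(2))
    then show False using frac_irrational[OF Suc.IH] by simp
  qed
qed

lemma frac_cf_complete_pos: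
  assumes "x \<notin> \<rat>"
  shows "0 < frac (cf_complete x n)"
  using frac_irrational[OF cf_complete_irrational[OF assms, of n]] frac_ge_0[of "cf_complete x n"]
  by (metis Rats_0 less_eq_real_def)

lemma cf_quot_ge_1:
  assumes "x \<notin> \<rat>"
  shows "1 \<le> cf_quot x (Suc n)"
  using frac_cf_complete_pos[OF assms, of n] frac_lt_1[of "cf_complete x n"]
  by (simp add: cf_quot_def field_simps)

lemma cf_denom_pos:
  assumes "x \<notin> \<rat>"
  shows "1 \<le> cf_denom x n"
proof (induction n rule: cf_denom.induct[where ?a0.0 = x and P = "\<lambda>_ n. 1 \<le> cf_denom x n", case_names A B C])
  case (B y)
  then show ?case using cf_quot_ge_1[OF assms, of 0] by simp
next
  case (C y n)
  have "1 * 1 \<le> cf_quot x (Suc (Suc n)) * cf_denom x (Suc n)"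
    using C cf_quot_ge_1[OF assms, of "Suc n"] by (intro mult_mono) auto
  then show ?case using C by simp
qed auto

text \<open>
  A complete quotient is minus the ratio of the two preceding errors: the recurrence of the
  convergents takes the integer part off this ratio, and the fractional part is what remains.
  So consecutive errors have opposite signs and decreasing absolute values.
\<close>

lemma cf_error_Suc:
  assumes "x \<notin> \<rat>"
  shows "cf_error x (Suc n) = - frac (cf_complete x (Suc n)) * cf_error x n"
proof (induction n)
  case 0
  have "frac x \<noteq> 0" using frac_cf_complete_pos[OF assms, of 0] by simp
  then show ?case
    by (simp add: cf_error_def cf_quot_def frac_def field_simps)
next
  case (Suc n)
  let ?y = "cf_complete x (Suc (Suc n))"
  have "frac (cf_complete x (Suc n)) > 0" by (rule frac_cf_complete_pos[OF assms])
  then have "cf_error x n = - ?y * cf_error x (Suc n)"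
    unfolding Suc.IH by simp
  moreover have "cf_error x (Suc (Suc n)) = of_int \<lfloor>?y\<rfloor> * cf_error x (Suc n) + cf_error x n"
    by (simp add: cf_error_def cf_quot_def algebra_simps)
  ultimately show ?case by (simp add: frac_def algebra_simps)
qed

lemma cf_determinant:
  "cf_denom x (Suc n) * cf_numer x n - cf_denom x n * cf_numer x (Suc n) = (- 1) ^ Suc n"
proof (induction n)
  case 0
  then show ?case by simp
next
  case (Suc n)
  then show ?case by (simp add: algebra_simps)
qed

text \<open>
  By the determinant identity the vectors \<open>(q\<^sub>n, p\<^sub>n)\<close> and \<open>(q\<^sub>n\<^sub>+\<^sub>1, p\<^sub>n\<^sub>+\<^sub>1)\<close> are a basis of the
  integer lattice, so \<open>(h, p)\<close> is \<open>X\<close> times the first plus \<open>Y\<close> times the second. The bounds on \<open>h\<close>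
  force \<open>X \<noteq> 0\<close> and forbid \<open>X\<close> and \<open>Y\<close> to have the same sign. As the two errors have opposite signs
  as well, their multiples add up without cancellation to at least one full error of index \<open>n\<close>.
\<close>

lemma cf_best_approximation:
  assumes x: "x \<notin> \<rat>" and h: "1 \<le> h" "h < cf_denom x (Suc n)"
  shows "\<bar>cf_error x n\<bar> \<le> \<bar>of_int h * x - of_int p\<bar>"
proof -
  define q q' r r' where "q = cf_denom x n" "q' = cf_denom x (Suc n)"
    "r = cf_numer x n" "r' = cf_numer x (Suc n)"
  note defs = this
  define D where "D = q' * r - q * r'"
  define f where "f = frac (cf_complete x (Suc n))"
  define X where "X = D * (q' * p - r' * h)"
  define Y where "Y = D * (r * h - q * p)"
  have "D = (- 1) ^ Suc n" unfolding D_def defs by (rule cf_determinant)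
  then have DD: "D * D = 1" by (simp flip: power_mult_distrib)
  have "X * q + Y * q' = D * D * h" by (simp add: X_def Y_def D_def algebra_simps)
  then have hX: "h = X * q + Y * q'" using DD by simp
  have "X * r + Y * r' = D * D * p" by (simp add: X_def Y_def D_def algebra_simps)
  then have pX: "p = X * r + Y * r'" using DD by simp
  have q: "1 \<le> q" "1 \<le> q'" using cf_denom_pos[OF x] by (simp_all add: defs)
  have hq: "h < q'" using h by (simp add: defs)
  have f: "0 \<le> f" by (simp add: f_def)
  have cases: "X \<ge> 1 \<and> Y \<le> 0 \<or> X \<le> -1 \<and> Y \<ge> 0"
  proof -
    have "X \<noteq> 0"
    proof
      assume "X = 0"
      then have "h = Y * q'" using hX by simp
      then have "0 < Y * q'" "Y * q' < 1 * q'" using h(1) hq by auto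
      then have "0 < Y" "Y < 1"
        using q by (auto simp: zero_less_mult_iff simp del: mult_1 intro: mult_right_less_imp_less)
      then show False by simp
    qed
    moreover have "\<not> (X \<ge> 1 \<and> Y \<ge> 1)"
    proof
      assume "X \<ge> 1 \<and> Y \<ge> 1"
      then have "0 \<le> X * q" "1 * q' \<le> Y * q'" using q by (auto intro!: mult_right_mono)
      then show False using hX hq by simp
    qed
    moreover have "\<not> (X \<le> -1 \<and> Y \<le> -1)"
    proof
      assume "X \<le> -1 \<and> Y \<le> -1"
      then have "X * q \<le> 0" "Y * q' \<le> 0" using q by (auto simp: mult_le_0_iff)
      then show False using hX h(1) by simp
    qed
    ultimately show ?thesis by linarith
  qed
  have "of_int h * x - of_int p = of_int X * cf_error x n + of_int Y * cf_error x (Suc n)"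
    unfolding hX pX by (simp add: cf_error_def defs algebra_simps)
  also have "\<dots> = cf_error x n * (of_int X - of_int Y * f)"
    unfolding cf_error_Suc[OF x] f_def by (simp add: algebra_simps)
  finally have eq: "\<bar>of_int h * x - of_int p\<bar> = \<bar>cf_error x n\<bar> * \<bar>of_int X - of_int Y * f\<bar>"
    by (simp add: abs_mult)
  have "1 \<le> \<bar>of_int X - of_int Y * f\<bar>"
    using cases
  proof
    assume "X \<ge> 1 \<and> Y \<le> 0"
    then have "of_int Y * f \<le> 0" "1 \<le> real_of_int X" using f by (auto simp: mult_le_0_iff)
    then show ?thesis by simp
  next
    assume "X \<le> -1 \<and> Y \<ge> 0"
    then have "0 \<le> of_int Y * f" "real_of_int X \<le> -1" using f by auto
    then show ?thesis by simp
  qed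
  then show ?thesis unfolding eq using mult_left_mono[of 1 _ "\<bar>cf_error x n\<bar>"] by simp
qed

lemma int_dist_le: "int_dist x \<le> \<bar>x - of_int m\<bar>"
  unfolding int_dist_def using round_diff_minimal[of x m] by simp

lemma int_dist_convergent_le:
  assumes "x \<notin> \<rat>" "1 \<le> h" "h < cf_denom x (Suc n)"
  shows "int_dist (of_int (cf_denom x n) * x) \<le> \<bar>of_int h * x - of_int p\<bar>"
proof -
  have "int_dist (of_int (cf_denom x n) * x) \<le> \<bar>cf_error x n\<bar>"
    unfolding cf_error_def by (rule int_dist_le)
  also have "\<dots> \<le> \<bar>of_int h * x - of_int p\<bar>" by (rule cf_best_approximation[OF assms])
  finally show ?thesis .
qed

text \<open>
  The determinant identity expresses 1 through the errors of index \<open>n\<close> and \<open>n + 1\<close>, the second of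
  which is the smaller one. Best approximation, applied to \<open>h = q\<^sub>n\<close> itself, shows that \<open>p\<^sub>n\<close> is a
  nearest integer to \<open>q\<^sub>n x\<close>; this fails when \<open>q\<^sub>n = q\<^sub>n\<^sub>+\<^sub>1 = 1\<close>, whence the strict inequality between the
  denominators.
\<close>

lemma int_dist_convergent_ge:
  assumes x: "x \<notin> \<rat>" and lt: "cf_denom x n < cf_denom x (Suc n)"
  shows "1 \<le> of_int (cf_denom x (Suc n) + cf_denom x n) * int_dist (of_int (cf_denom x n) * x)"
proof -
  let ?q = "real_of_int (cf_denom x n)" and ?q' = "real_of_int (cf_denom x (Suc n))"
  have q: "0 \<le> ?q" "0 \<le> ?q'" using cf_denom_pos[OF x, of n] cf_denom_pos[OF x, of "Suc n"] by simp_all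
  have "?q' * cf_error x n - ?q * cf_error x (Suc n)
      = - of_int (cf_denom x (Suc n) * cf_numer x n - cf_denom x n * cf_numer x (Suc n))"
    by (simp add: cf_error_def algebra_simps)
  then have "1 = \<bar>?q' * cf_error x n - ?q * cf_error x (Suc n)\<bar>"
    unfolding cf_determinant by simp
  also have "\<dots> \<le> ?q' * \<bar>cf_error x n\<bar> + ?q * \<bar>cf_error x (Suc n)\<bar>"
    using q by (metis abs_mult abs_of_nonneg abs_triangle_ineq4)
  also have "\<bar>cf_error x (Suc n)\<bar> \<le> 1 * \<bar>cf_error x n\<bar>"
    unfolding cf_error_Suc[OF x] abs_mult abs_minus using frac_lt_1[of "cf_complete x (Suc n)"]
    by (intro mult_right_mono) (auto simp: frac_ge_0)
  also have "?q' * \<bar>cf_error x n\<bar> + ?q * (1 * \<bar>cf_error x n\<bar>) = (?q' + ?q) * \<bar>cf_error x n\<bar>"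
    by (simp add: algebra_simps)
  also have "\<bar>cf_error x n\<bar> \<le> int_dist (?q * x)"
    unfolding int_dist_def using cf_denom_pos[OF x, of n] lt by (intro cf_best_approximation[OF x]) auto
  finally show ?thesis using q by (simp add: mult_left_mono)
qed

section \<open>Floor sums\<close>

definition floor_sum :: "int \<Rightarrow> int \<Rightarrow> int \<Rightarrow> int \<Rightarrow> int" where
  "floor_sum n a b m = (\<Sum>j\<in>{0..<n}. (a * j + b) div m)"

lemma sum_int_lessThan:
  assumes "0 \<le> n"
  shows "(\<Sum>j\<in>{0..<n}. j) = n * (n - 1) div (2::int)"
proof -
  have "2 * (\<Sum>j\<in>{0..<n}. j) = n * (n - 1)"
    using assms
  proof (induction n rule: int_ge_induct)
    case (step i)
    have "{0..<i + 1} = insert i {0..<i}" using step by auto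
    then show ?case using step by (simp add: algebra_simps)
  qed simp
  then show ?thesis by presburger
qed

lemma floor_sum_reduce:
  assumes "0 \<le> n" "0 < m"
  shows "floor_sum n a b m =
    n * (n - 1) div 2 * (a div m) + n * (b div m) + floor_sum n (a mod m) (b mod m) m"
proof -
  have *: "(a * j + b) div m = j * (a div m) + b div m + (a mod m * j + b mod m) div m" for j
  proof -
    have "a * j + b = (a div m * m + a mod m) * j + (b div m * m + b mod m)" by simp
    also have "\<dots> = (a mod m * j + b mod m) + (j * (a div m) + b div m) * m" by algebra
    finally show ?thesis using assms by simp
  qed
  have "floor_sum n a b m = (\<Sum>j\<in>{0..<n}. j) * (a div m) + n * (b div m) + floor_sum n (a mod m) (b mod m) m"
    unfolding floor_sum_def * using assms by (simp add: sum.distrib sum_distrib_right)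
  then show ?thesis by (simp add: sum_int_lessThan assms)
qed

lemma div_eq_sum_of_bool:
  fixes x :: int
  assumes "0 < m" "0 \<le> x" "x div m \<le> K"
  shows "x div m = (\<Sum>i\<in>{1..K}. of_bool (i * m \<le> x))"
proof -
  have "i * m \<le> x \<longleftrightarrow> i \<le> x div m" for i
  proof
    assume "i * m \<le> x"
    from zdiv_mono1[OF this assms(1)] assms(1) show "i \<le> x div m" by simp
  next
    assume "i \<le> x div m"
    then have "i * m \<le> x div m * m" using assms(1) by (intro mult_right_mono) auto
    also have "\<dots> \<le> x" using pos_mod_sign[OF assms(1), of x] div_mult_mod_eq[of x m] by linarith
    finally show "i * m \<le> x" .
  qed
  then have "{1..K} \<inter> {i. i * m \<le> x} = {1..K} \<inter> {i. i \<le> x div m}" by simp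
  also have "\<dots> = {1..x div m}" using assms(3) by auto
  finally have "{1..K} \<inter> {i. i * m \<le> x} = {1..x div m}" .
  moreover have "0 \<le> x div m" using assms by (simp add: pos_imp_zdiv_nonneg_iff)
  ultimately show ?thesis by (simp add: sum_of_bool_eq)
qed

text \<open>
  Both sides count the lattice points \<open>(j, i)\<close> with \<open>0 \<le> j < n\<close>, \<open>1 \<le> i\<close> and \<open>i m \<le> a j + b\<close>, the left
  one column by column and the right one row by row. Reversing both axes, that is replacing \<open>j\<close>
  by \<open>n - j\<close> and \<open>i\<close> by \<open>(a n + b) div m - i\<close>, makes the row lengths a floor sum again.
\<close>

lemma floor_sum_swap:
  assumes n: "0 \<le> n" and a: "0 \<le> a" "a < m" and b: "0 \<le> b" "b < m"
  shows "floor_sum n a b m = floor_sum ((a * n + b) div m) m ((a * n + b) mod m) a"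
proof (cases "a = 0")
  case True
  then show ?thesis using b by (simp add: floor_sum_def)
next
  case False
  then have a0: "0 < a" and m: "0 < m" using a by auto
  define y K r where "y = a * n + b" and "K = y div m" and "r = y mod m"
  have ym: "y = K * m + r" by (simp add: K_def r_def)
  have ymod: "0 \<le> r" using m by (simp add: r_def)
  have y0: "0 \<le> y" using n a b by (simp add: y_def)
  have "floor_sum n a b m = (\<Sum>j\<in>{0..<n}. \<Sum>i\<in>{1..K}. of_bool (i * m \<le> a * j + b))"
    unfolding floor_sum_def
  proof (rule sum.cong[OF refl])
    fix j assume j: "j \<in> {0..<n}"
    have "a * j \<le> a * n" using j a by (intro mult_left_mono) auto
    then have "(a * j + b) div m \<le> K" unfolding K_def y_def using m by (intro zdiv_mono1) auto
    moreover have "0 \<le> a * j + b" using j a b by simp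
    ultimately show "(a * j + b) div m = (\<Sum>i\<in>{1..K}. of_bool (i * m \<le> a * j + b))"
      using m by (intro div_eq_sum_of_bool) auto
  qed
  also have "\<dots> = (\<Sum>i\<in>{1..K}. \<Sum>j\<in>{0..<n}. of_bool (i * m \<le> a * j + b))"
    by (rule sum.swap)
  also have "\<dots> = (\<Sum>i\<in>{1..K}. (y - i * m) div a)"
  proof (rule sum.cong[OF refl])
    fix i assume i: "i \<in> {1..K}"
    have "(\<Sum>j\<in>{0..<n}. of_bool (i * m \<le> a * j + b)) = (\<Sum>j\<in>{1..n}. of_bool (j * a \<le> y - i * m) :: int)"
      by (rule sum.reindex_bij_witness[of _ "\<lambda>j. n - j" "\<lambda>j. n - j"]) (auto simp: y_def algebra_simps)
    also have "\<dots> = (y - i * m) div a"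
    proof (rule div_eq_sum_of_bool[symmetric, OF a0])
      have "i * m \<le> K * m" using i m by (intro mult_right_mono) auto
      then show "0 \<le> y - i * m" using ym ymod by linarith
      have "1 * m \<le> i * m" using i m by (intro mult_right_mono) auto
      moreover have "y = n * a + b" by (simp add: y_def)
      ultimately have "y - i * m \<le> n * a" using b by linarith
      from zdiv_mono1[OF this a0] show "(y - i * m) div a \<le> n" using a0 by simp
    qed
    finally show "(\<Sum>j\<in>{0..<n}. of_bool (i * m \<le> a * j + b)) = (y - i * m) div a" .
  qed
  also have "\<dots> = (\<Sum>i\<in>{0..<K}. (m * i + r) div a)"
  proof (rule sum.reindex_bij_witness[of _ "\<lambda>i. K - i" "\<lambda>i. K - i"])
    fix i assume "i \<in> {1..K}"
    have "m * (K - i) + r = y - i * m" using ym by (simp add: algebra_simps)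
    then show "(m * (K - i) + r) div a = (y - i * m) div a" by simp
  qed auto
  finally show ?thesis by (simp add: floor_sum_def y_def K_def r_def)
qed

section \<open>Timed execution\<close>

text \<open>
  A weakest precondition with a clock: \<open>T\<close> is the time at which \<open>p\<close> starts, and \<open>\<Phi>\<close> may speak of
  the time and the state at the end. Carrying the time forward keeps the rule for sequences free
  of arithmetic.
\<close>

definition runs :: "com \<Rightarrow> state \<Rightarrow> nat \<Rightarrow> (nat \<Rightarrow> state \<Rightarrow> bool) \<Rightarrow> bool" where
  "runs p s T \<Phi> \<longleftrightarrow> (\<exists>n s'. exec p s n s' \<and> \<Phi> (T + n) s')"

lemma runs_mono:
  assumes "runs p s T \<Phi>" and "\<And>T' s'. \<Phi> T' s' \<Longrightarrow> \<Psi> T' s'"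
  shows "runs p s T \<Psi>"
  using assms unfolding runs_def by blast

lemma runs_Assign [simp]: "runs (x ::= e) s T \<Phi> \<longleftrightarrow> \<Phi> (T + (acost e + 1)) (s(x := aval e s))"
  unfolding runs_def by (metis exec.Assign exec_deterministic)

lemma runs_Seq [simp]: "runs (p;; q) s T \<Phi> \<longleftrightarrow> runs p s T (\<lambda>T' s'. runs q s' T' \<Phi>)"
  unfolding runs_def by (auto simp: add.assoc elim!: exec_SeqE) (metis exec.Seq add.assoc)+

lemma runs_Cond [simp]:
  "runs (IF e THEN p ELSE q) s T \<Phi> \<longleftrightarrow> runs (if bval e s then p else q) s (T + bcost e) \<Phi>"
  unfolding runs_def
  by (auto simp: add.assoc elim!: exec_CondE) (metis exec.IfTrue exec.IfFalse add.assoc)+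

lemma runs_While:
  "runs (WHILE e DO p) s T \<Phi> \<longleftrightarrow>
    (if bval e s then runs p s (T + bcost e) (\<lambda>T' s'. runs (WHILE e DO p) s' T' \<Phi>)
     else \<Phi> (T + bcost e) s)"
proof (cases "bval e s")
  case True
  then have "exec (WHILE e DO p) s n s' \<longleftrightarrow>
      (\<exists>i j t. n = bcost e + i + j \<and> exec p s i t \<and> exec (WHILE e DO p) t j s')" for n s'
    by (blast elim: exec_WhileE intro: exec.WhileTrue)
  then show ?thesis using True unfolding runs_def by (simp add: add.assoc) (metis add.assoc)
next
  case False
  then have "exec (WHILE e DO p) s n s' \<longleftrightarrow> n = bcost e \<and> s' = s" for n s'
    by (auto elim: exec_WhileE intro: exec.WhileFalse)
  then show ?thesis using False unfolding runs_def by auto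
qed

section \<open>The counting and reporting programs\<close>

text \<open>
  The bodies of the two loops are projected out of the programs so that loop invariants can refer
  to them.
\<close>

definition floor_sum_body :: com where
  "floor_sum_body = (case floor_sum_prog of Seq _ (While _ p) \<Rightarrow> p)"

lemma floor_sum_prog_eq:
  "floor_sum_prog = (''r'' ::= N 0;; WHILE N 0 LESS V ''n'' DO floor_sum_body)"
  by (simp add: floor_sum_prog_def floor_sum_body_def)

abbreviation floor_sum_vars :: "vname set" where
  "floor_sum_vars \<equiv> {''r'', ''a'', ''b'', ''y'', ''n'', ''t'', ''m''}"

text \<open>
  For the pair \<open>(a, m)\<close> with \<open>r = a mod m\<close>, the next pair in Euclid's algorithm is \<open>(m, r)\<close>. Hence this
  says that the potential \<open>m * (a mod m)\<close> is at least halved; \<open>m\<close> alone need not be.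
\<close>

lemma mult_mod_halves:
  fixes m r :: int
  assumes "0 < r" "r < m"
  shows "2 * (r * (m mod r)) \<le> m * r"
proof -
  have "r * 1 \<le> r * (m div r)"
    using assms by (intro mult_left_mono) (auto simp: int_one_le_iff_zero_less pos_imp_zdiv_pos_iff)
  then have "2 * (m mod r) \<le> m"
    using mult_div_mod_eq[of r m] pos_mod_bound[OF assms(1), of m] by linarith
  then have "r * (2 * (m mod r)) \<le> r * m" using assms by (intro mult_left_mono) auto
  then show ?thesis by (simp add: algebra_simps)
qed

text \<open>
  The loop makes at most \<open>i\<close> rounds once the potential \<open>m * (a mod m)\<close> is below \<open>2\<^sup>i\<^sup>-\<^sup>1\<close>. When the
  potential reaches 0 because \<open>m\<close> divides \<open>a\<close>, one more round sets \<open>n\<close> to 0. A round and its guard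
  cost 25 steps.
\<close>

lemma runs_floor_sum_loop:
  assumes "0 \<le> s ''n''" "0 \<le> s ''a''" "0 < s ''n'' \<Longrightarrow> 0 < s ''m''"
    and "s ''n'' = 0 \<or> 0 < i \<and> s ''m'' * (s ''a'' mod s ''m'') < 2 ^ (i - 1)"
  shows "runs (WHILE N 0 LESS V ''n'' DO floor_sum_body) s T
    (\<lambda>T' s'. T' \<le> T + 25 * i + 1 \<and>
      s' ''r'' = s ''r'' + floor_sum (s ''n'') (s ''a'') (s ''b'') (s ''m'') \<and>
      (\<forall>x. x \<notin> floor_sum_vars \<longrightarrow> s' x = s x))"
  using assms
proof (induction i arbitrary: s T)
  case 0
  then show ?case by (subst runs_While) (simp add: floor_sum_def)
next
  case (Suc i)
  show ?case
  proof (cases "s ''n'' = 0")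
    case True
    then show ?thesis by (subst runs_While) (simp add: floor_sum_def)
  next
    case False
    define n a b m where "n = s ''n''" and "a = s ''a''" and "b = s ''b''" and "m = s ''m''"
    have n: "0 < n" using Suc.prems(1) False by (simp add: n_def)
    have m: "0 < m" using Suc.prems(3) n by (simp add: n_def m_def)
    have small: "m * (a mod m) < 2 ^ i" using Suc.prems(4) False by (simp add: a_def m_def)
    define r y where "r = a mod m" and "y = r * n + b mod m"
    have r: "0 \<le> r" "r < m" using m by (simp_all add: r_def)
    have y: "0 \<le> y" using n r m by (simp add: y_def)
    define s2 where "s2 = s(''r'' := s ''r'' + n * (n - 1) div 2 * (a div m) + n * (b div m),
      ''y'' := y, ''n'' := y div m, ''b'' := y mod m, ''t'' := m, ''m'' := r, ''a'' := m)"
    have body: "runs floor_sum_body s (T + 1) \<Psi> \<longleftrightarrow> \<Psi> (T + 25) s2" for \<Psi>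
      unfolding floor_sum_body_def floor_sum_prog_def s2_def
      by (simp add: n_def a_def b_def m_def y_def r_def fun_upd_twist numeral_eq_Suc)
    have "floor_sum n a b m = n * (n - 1) div 2 * (a div m) + n * (b div m) + floor_sum n r (b mod m) m"
      unfolding r_def using n m by (intro floor_sum_reduce) auto
    also have "floor_sum n r (b mod m) m = floor_sum (y div m) m (y mod m) r"
      unfolding y_def using n m r by (intro floor_sum_swap) auto
    finally have sum: "floor_sum n a b m =
      n * (n - 1) div 2 * (a div m) + n * (b div m) + floor_sum (y div m) m (y mod m) r" .
    \<comment> \<open>The modulus can become 0 only together with the number of summands.\<close>
    have r0: "0 < r" if "0 < y div m"
    proof (rule ccontr)
      assume "\<not> 0 < r"
      then have "y = b mod m" using r by (simp add: y_def)
      then show False using that m by simp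
    qed
    have y0: "0 \<le> y div m" using y m by (simp add: pos_imp_zdiv_nonneg_iff)
    have step: "y div m = 0 \<or> 0 < i \<and> r * (m mod r) < 2 ^ (i - 1)"
    proof (cases "y div m = 0")
      case False
      then have pos: "0 < r" using r0 y0 by simp
      then have "1 * 1 \<le> m * r" using m by (intro mult_mono) auto
      then obtain i' where i': "i = Suc i'" using small by (cases i) (auto simp: r_def)
      then show ?thesis using mult_mod_halves[OF pos r(2)] small by (simp add: r_def)
    qed simp
    have "runs (WHILE N 0 LESS V ''n'' DO floor_sum_body) s2 (T + 25)
      (\<lambda>T' s'. T' \<le> T + 25 + 25 * i + 1 \<and>
        s' ''r'' = s2 ''r'' + floor_sum (s2 ''n'') (s2 ''a'') (s2 ''b'') (s2 ''m'') \<and>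
        (\<forall>x. x \<notin> floor_sum_vars \<longrightarrow> s' x = s2 x))"
      using y0 m r0 step by (intro Suc.IH) (auto simp: s2_def)
    then have "runs (WHILE N 0 LESS V ''n'' DO floor_sum_body) s2 (T + 25)
      (\<lambda>T' s'. T' \<le> T + 25 * Suc i + 1 \<and>
        s' ''r'' = s ''r'' + floor_sum (s ''n'') (s ''a'') (s ''b'') (s ''m'') \<and>
        (\<forall>x. x \<notin> floor_sum_vars \<longrightarrow> s' x = s x))"
      by (rule runs_mono) (use sum in \<open>auto simp: s2_def n_def a_def b_def m_def\<close>)
    then show ?thesis
      using n by (subst runs_While) (simp add: body[simplified] n_def)
  qed
qed

text \<open>
  The candidates up to \<open>w\<close> for the numbers stored in a state, with membership in the arc expressed by
  residues, which is the form in which the program counts them.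
\<close>

definition hits :: "state \<Rightarrow> int \<Rightarrow> int set" where
  "hits s w = {j\<in>{1..w}. (s ''B'' + s ''P'' * j - s ''l'') mod s ''Q'' \<le> s ''u'' - s ''l''}"

lemma div_diff_eq_of_bool:
  fixes x w Q :: int
  assumes "0 < w" "w \<le> Q"
  shows "x div Q - (x - w) div Q = of_bool (x mod Q < w)"
proof -
  have Q: "0 < Q" using assms by simp
  have "(x - w) div Q = x div Q + (x mod Q - w) div Q"
  proof -
    have "x - w = (x mod Q - w) + x div Q * Q" using div_mult_mod_eq[of x Q] by linarith
    then have "(x - w) div Q = ((x mod Q - w) + x div Q * Q) div Q" by (rule arg_cong)
    also have "\<dots> = x div Q + (x mod Q - w) div Q" using Q by (intro div_mult_self1) simp
    finally show ?thesis .
  qed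
  moreover have "(x mod Q - w) div Q = - of_bool (x mod Q < w)"
  proof (cases "x mod Q < w")
    case True
    have "(x mod Q - w) div Q = -1"
      using True assms Q pos_mod_sign[OF Q, of x] by (intro int_div_pos_eq[where r = "x mod Q - w + Q"]) auto
    then show ?thesis using True by simp
  next
    case False
    then show ?thesis using assms Q pos_mod_bound[OF Q, of x] by simp
  qed
  ultimately show ?thesis by simp
qed

text \<open>
  With \<open>v = u - l + 1\<close>, the difference of the floors of \<open>x / Q\<close> and \<open>(x - v) / Q\<close> is 1 exactly if
  \<open>x mod Q < v\<close>, provided that \<open>1 \<le> v \<le> Q\<close>. The shift by \<open>P\<close> in the constant terms turns the range
  \<open>1 \<le> j \<le> w\<close> into \<open>0 \<le> j < w\<close>.
\<close>

lemma card_hits: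
  assumes "0 \<le> w" "0 < s ''Q''" "s ''l'' \<le> s ''u''" "s ''u'' - s ''l'' < s ''Q''"
  shows "int (card (hits s w)) =
    floor_sum w (s ''P'') (s ''B'' + s ''P'' - s ''l'') (s ''Q'') -
    floor_sum w (s ''P'') (s ''B'' + s ''P'' - s ''u'' - 1) (s ''Q'')"
proof -
  let ?x = "\<lambda>j. s ''B'' + s ''P'' * j - s ''l''" and ?v = "s ''u'' - s ''l'' + 1" and ?Q = "s ''Q''"
  have "{1..w} \<inter> {j. ?x j mod ?Q < ?v} = hits s w"
    by (auto simp: hits_def)
  then have "int (card (hits s w)) = (\<Sum>j\<in>{1..w}. of_bool (?x j mod ?Q < ?v))"
    by (simp add: sum_of_bool_eq)
  also have "\<dots> = (\<Sum>j\<in>{1..w}. ?x j div ?Q - (?x j - ?v) div ?Q)"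
    using assms by (intro sum.cong refl div_diff_eq_of_bool[symmetric]) auto
  also have "\<dots> = (\<Sum>j\<in>{0..<w}. ?x (j + 1) div ?Q - (?x (j + 1) - ?v) div ?Q)"
    by (rule sum.reindex_bij_witness[of _ "\<lambda>j. j + 1" "\<lambda>j. j - 1"]) auto
  finally show ?thesis
    by (simp add: floor_sum_def sum_subtractf algebra_simps)
qed

abbreviation count_vars :: "vname set" where
  "count_vars \<equiv> insert ''cnt'' floor_sum_vars"

lemma runs_floor_sum_prog:
  assumes "0 \<le> s ''n''" "0 \<le> s ''a''" "0 < s ''m''" "s ''m'' < 2 ^ L"
  shows "runs floor_sum_prog s T
    (\<lambda>T' s'. T' \<le> T + 50 * L + 27 \<and>
      s' ''r'' = floor_sum (s ''n'') (s ''a'') (s ''b'') (s ''m'') \<and>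
      (\<forall>x. x \<notin> floor_sum_vars \<longrightarrow> s' x = s x))"
proof -
  let ?m = "s ''m''" and ?s = "s(''r'' := 0)"
  \<comment> \<open>The potential is below \<open>m\<^sup>2 < 2\<^sup>2\<^sup>L\<close>, which allows \<open>2 L + 1\<close> rounds.\<close>
  have "?m * (s ''a'' mod ?m) \<le> ?m * ?m" using assms(3)
    by (intro mult_left_mono less_imp_le[OF pos_mod_bound]) auto
  also have "\<dots> < 2 ^ L * 2 ^ L" using assms by (intro mult_strict_mono) auto
  finally have small: "?m * (s ''a'' mod ?m) < 2 ^ (2 * L + 1 - 1)" by (simp add: mult_2 power_add)
  have "runs (WHILE N 0 LESS V ''n'' DO floor_sum_body) ?s (T + 1)
    (\<lambda>T' s'. T' \<le> T + 1 + 25 * (2 * L + 1) + 1 \<and>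
      s' ''r'' = ?s ''r'' + floor_sum (?s ''n'') (?s ''a'') (?s ''b'') (?s ''m'') \<and>
      (\<forall>x. x \<notin> floor_sum_vars \<longrightarrow> s' x = ?s x))"
    using assms small by (intro runs_floor_sum_loop) auto
  then have "runs (WHILE N 0 LESS V ''n'' DO floor_sum_body) ?s (T + 1)
    (\<lambda>T' s'. T' \<le> T + 50 * L + 27 \<and>
      s' ''r'' = floor_sum (s ''n'') (s ''a'') (s ''b'') (s ''m'') \<and>
      (\<forall>x. x \<notin> floor_sum_vars \<longrightarrow> s' x = s x))"
    by (rule runs_mono) auto
  then show ?thesis by (simp add: floor_sum_prog_eq)
qed

definition searchable :: "state \<Rightarrow> nat \<Rightarrow> bool" where
  "searchable s L \<longleftrightarrow> 0 \<le> s ''P'' \<and> 0 < s ''Q'' \<and> s ''Q'' < 2 ^ L \<and>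
    s ''l'' \<le> s ''u'' \<and> s ''u'' - s ''l'' < s ''Q''"

lemma runs_count_prog:
  assumes "searchable s L" "0 \<le> s ''w''"
  shows "runs count_prog s T
    (\<lambda>T' s'. T' \<le> T + 100 * L + 70 \<and> s' ''cnt'' = int (card (hits s (s ''w''))) \<and>
      (\<forall>x. x \<notin> count_vars \<longrightarrow> s' x = s x))"
proof -
  have S: "0 \<le> s ''P''" "0 < s ''Q''" "s ''Q'' < 2 ^ L" "s ''l'' \<le> s ''u''" "s ''u'' - s ''l'' < s ''Q''"
    using assms(1) by (auto simp: searchable_def)
  note card = card_hits[OF assms(2) S(2,4,5)]
  show ?thesis
    unfolding count_prog_def runs_Seq runs_Assign
  proof (rule runs_mono[OF runs_floor_sum_prog[where L = L]], goal_cases)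
    case (5 T1 s1)
    note first = 5
    show ?case
    proof (rule runs_mono[OF runs_floor_sum_prog[where L = L]], goal_cases)
      case (5 T2 s2)
      then show ?case using first by (auto simp: card)
    qed (use first S assms(2) in simp_all)
  qed (use S assms(2) in simp_all)
qed

definition search_body :: com where
  "search_body = (case report_prog of Seq _ (Cond _ _ (Seq (Seq _ (While _ p)) _)) \<Rightarrow> p)"

lemma report_prog_eq:
  "report_prog =
     (''w'' ::= V ''H'';;
      count_prog;;
      IF V ''cnt'' LESS N 1 THEN ''out'' ::= N 0
      ELSE (
        ''lo'' ::= N 0;;
        ''hi'' ::= V ''H'';;
        WHILE V ''lo'' \<oplus> N 1 LESS V ''hi'' DO search_body;;
        ''out'' ::= V ''hi''))"
  by (simp add: report_prog_def search_body_def)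

lemma finite_hits [simp]: "finite (hits s w)"
  by (rule finite_subset[of _ "{1..w}"]) (auto simp: hits_def)

lemma hits_cong:
  assumes "s' ''B'' = s ''B''" "s' ''P'' = s ''P''" "s' ''Q'' = s ''Q''" "s' ''l'' = s ''l''" "s' ''u'' = s ''u''"
  shows "hits s' w = hits s w"
  using assms by (simp add: hits_def)

lemma searchable_cong:
  assumes "s' ''B'' = s ''B''" "s' ''P'' = s ''P''" "s' ''Q'' = s ''Q''" "s' ''l'' = s ''l''" "s' ''u'' = s ''u''"
  shows "searchable s' L = searchable s L"
  using assms by (simp add: searchable_def)

lemma runs_search_body:
  assumes "searchable s L" "0 \<le> s ''lo''" "0 \<le> s ''hi''"
  defines "w \<equiv> (s ''lo'' + s ''hi'') div 2"
  shows "runs search_body s T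
    (\<lambda>T' s'. T' \<le> T + 100 * L + 75 \<and>
      s' ''lo'' = (if hits s w = {} then w else s ''lo'') \<and>
      s' ''hi'' = (if hits s w = {} then s ''hi'' else w) \<and>
      (\<forall>x. x \<notin> count_vars \<union> {''w'', ''lo'', ''hi''} \<longrightarrow> s' x = s x))"
proof -
  let ?s = "s(''w'' := w)"
  have hits: "hits ?s w = hits s w" by (rule hits_cong) auto
  have "searchable ?s L \<longleftrightarrow> searchable s L" by (rule searchable_cong) auto
  then have "runs count_prog ?s (T + 3)
    (\<lambda>T' s'. T' \<le> T + 3 + 100 * L + 70 \<and> s' ''cnt'' = int (card (hits ?s (?s ''w''))) \<and>
      (\<forall>x. x \<notin> count_vars \<longrightarrow> s' x = ?s x))"
    using assms by (intro runs_count_prog) auto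
  then have "runs count_prog ?s (T + 3)
    (\<lambda>T' s'. runs (IF V ''cnt'' LESS N 1 THEN ''lo'' ::= V ''w'' ELSE ''hi'' ::= V ''w'') s' T'
      (\<lambda>T' s'. T' \<le> T + 100 * L + 75 \<and>
        s' ''lo'' = (if hits s w = {} then w else s ''lo'') \<and>
        s' ''hi'' = (if hits s w = {} then s ''hi'' else w) \<and>
        (\<forall>x. x \<notin> count_vars \<union> {''w'', ''lo'', ''hi''} \<longrightarrow> s' x = s x)))"
    by (rule runs_mono) (auto simp: hits)
  then show ?thesis
    by (simp add: search_body_def report_prog_def w_def numeral_eq_Suc)
qed

text \<open>
  Bisection keeps the invariant that there is no hit up to \<open>lo\<close> and at least one up to \<open>hi\<close>. It ends
  with \<open>hi = lo + 1\<close>, so that \<open>hi\<close> is the least hit.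
\<close>

lemma runs_search_loop:
  assumes "searchable s L" "0 \<le> s ''lo''" "s ''lo'' < s ''hi''" "s ''hi'' - s ''lo'' \<le> 2 ^ i"
    and "hits s (s ''lo'') = {}" "hits s (s ''hi'') \<noteq> {}"
  shows "runs (WHILE V ''lo'' \<oplus> N 1 LESS V ''hi'' DO search_body) s T
    (\<lambda>T' s'. T' \<le> T + (100 * L + 77) * i + 2 \<and> 1 \<le> s' ''hi'' \<and> s' ''hi'' \<le> s ''hi'' \<and>
      hits s (s' ''hi'' - 1) = {} \<and> hits s (s' ''hi'') \<noteq> {})"
  using assms
proof (induction i arbitrary: s T)
  case 0
  then have "s ''hi'' = s ''lo'' + 1" by simp
  then show ?case using 0 by (subst runs_While) simp
next
  case (Suc i)
  show ?case
  proof (cases "s ''lo'' + 1 < s ''hi''")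
    case False
    then have "s ''hi'' = s ''lo'' + 1" using Suc.prems by simp
    then show ?thesis using Suc.prems by (subst runs_While) simp
  next
    case True
    let ?loop = "WHILE V ''lo'' \<oplus> N 1 LESS V ''hi'' DO search_body"
    define w where "w = (s ''lo'' + s ''hi'') div 2"
    define \<Phi> where "\<Phi> = (\<lambda>T' s'. T' \<le> T + (100 * L + 77) * Suc i + 2 \<and> 1 \<le> s' ''hi'' \<and>
      s' ''hi'' \<le> s ''hi'' \<and> hits s (s' ''hi'' - 1) = {} \<and> hits s (s' ''hi'') \<noteq> {})"
    have w: "s ''lo'' < w" "w < s ''hi''" using True by (auto simp: w_def)
    have gap: "w - s ''lo'' \<le> 2 ^ i" "s ''hi'' - w \<le> 2 ^ i"
      using Suc.prems(4) unfolding w_def by auto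
    have "runs search_body s (T + 2) (\<lambda>T' s'. runs ?loop s' T' \<Phi>)"
    proof (rule runs_mono[OF runs_search_body[where L = L]], goal_cases)
      case (4 T' s')
      then have s': "s' ''lo'' = (if hits s w = {} then w else s ''lo'')"
          "s' ''hi'' = (if hits s w = {} then s ''hi'' else w)"
        and frame: "\<forall>x. x \<notin> count_vars \<union> {''w'', ''lo'', ''hi''} \<longrightarrow> s' x = s x"
        and T': "T' \<le> T + 2 + 100 * L + 75"
        by (simp_all add: w_def)
      have hits: "hits s' v = hits s v" for v by (rule hits_cong) (use frame in simp_all)
      have S: "searchable s' L"
        using Suc.prems(1) by (subst searchable_cong[of s' s]) (use frame in simp_all)
      have "runs ?loop s' T'
        (\<lambda>T'' s''. T'' \<le> T' + (100 * L + 77) * i + 2 \<and> 1 \<le> s'' ''hi'' \<and> s'' ''hi'' \<le> s' ''hi'' \<and>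
          hits s' (s'' ''hi'' - 1) = {} \<and> hits s' (s'' ''hi'') \<noteq> {})"
        using S Suc.prems w gap by (intro Suc.IH) (auto simp: hits s')
      then show ?case
        by (rule runs_mono) (use T' w in \<open>auto simp: \<Phi>_def hits s' split: if_splits\<close>)
    qed (use Suc.prems in auto)
    then show ?thesis
      using True unfolding \<Phi>_def by (subst runs_While) simp
  qed
qed

text \<open>
  The coarse time bound covers one count of at most \<open>100 L + 70\<close> steps for the whole range and at
  most \<open>i\<close> rounds of bisection, each of which takes at most \<open>100 L + 77\<close> steps.
\<close>

lemma runs_report_prog:
  assumes "searchable s L" "1 \<le> s ''H''" "s ''H'' \<le> 2 ^ i"
  shows "runs report_prog s 0
    (\<lambda>T s'. T \<le> 100 * (L + 1) * (i + 1) \<and>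
      (if hits s (s ''H'') = {} then s' ''out'' = 0
       else 1 \<le> s' ''out'' \<and> s' ''out'' \<le> s ''H'' \<and>
         hits s (s' ''out'' - 1) = {} \<and> hits s (s' ''out'') \<noteq> {}))"
proof -
  let ?s = "s(''w'' := s ''H'')" and ?H = "s ''H''"
  let ?loop = "WHILE V ''lo'' \<oplus> N 1 LESS V ''hi'' DO search_body"
  define \<Phi> where "\<Phi> = (\<lambda>T s'. T \<le> 100 * (L + 1) * (i + 1) \<and>
      (if hits s ?H = {} then s' ''out'' = 0
       else 1 \<le> s' ''out'' \<and> s' ''out'' \<le> ?H \<and>
         hits s (s' ''out'' - 1) = {} \<and> hits s (s' ''out'') \<noteq> {}))"
  have hits: "hits ?s v = hits s v" for v by (rule hits_cong) auto
  have "searchable ?s L \<longleftrightarrow> searchable s L" by (rule searchable_cong) auto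
  then have "runs count_prog ?s 1
    (\<lambda>T' s'. T' \<le> 1 + 100 * L + 70 \<and> s' ''cnt'' = int (card (hits ?s (?s ''w''))) \<and>
      (\<forall>x. x \<notin> count_vars \<longrightarrow> s' x = ?s x))"
    using assms by (intro runs_count_prog) auto
  then have "runs count_prog ?s 1
    (\<lambda>T' s'. runs (IF V ''cnt'' LESS N 1 THEN ''out'' ::= N 0
      ELSE (''lo'' ::= N 0;; ''hi'' ::= V ''H'';; ?loop;; ''out'' ::= V ''hi'')) s' T' \<Phi>)"
  proof (rule runs_mono, goal_cases)
    case (1 T' s1)
    then have T': "T' \<le> 100 * L + 71" and cnt: "s1 ''cnt'' = int (card (hits s ?H))"
      and frame: "\<forall>x. x \<notin> count_vars \<longrightarrow> s1 x = ?s x"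
      by (simp_all add: hits)
    show ?case
    proof (cases "hits s ?H = {}")
      case True
      then show ?thesis using T' cnt by (simp add: \<Phi>_def)
    next
      case False
      let ?s2 = "s1(''lo'' := 0, ''hi'' := ?H)"
      have hits2: "hits ?s2 v = hits s v" for v by (rule hits_cong) (use frame in simp_all)
      have S2: "searchable ?s2 L"
        using assms(1) by (subst searchable_cong[of ?s2 s]) (use frame in simp_all)
      have "hits s 0 = {}" by (simp add: hits_def)
      then have "runs ?loop ?s2 (T' + 3)
        (\<lambda>T s'. T \<le> T' + 3 + (100 * L + 77) * i + 2 \<and> 1 \<le> s' ''hi'' \<and> s' ''hi'' \<le> ?s2 ''hi'' \<and>
          hits ?s2 (s' ''hi'' - 1) = {} \<and> hits ?s2 (s' ''hi'') \<noteq> {})"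
        using assms S2 False by (intro runs_search_loop) (auto simp: hits2)
      then have "runs ?loop ?s2 (T' + 3) (\<lambda>T s'. \<Phi> (T + 1) (s'(''out'' := s' ''hi'')))"
        by (rule runs_mono) (use T' False in \<open>auto simp: \<Phi>_def hits2 algebra_simps\<close>)
      moreover have "card (hits s ?H) \<noteq> 0" using False by simp
      ultimately show ?thesis using cnt frame by (simp add: numeral_eq_Suc)
    qed
  qed
  then have "runs report_prog s 0 \<Phi>" by (simp add: report_prog_eq)
  then show ?thesis unfolding \<Phi>_def .
qed

section \<open>Residues and arcs\<close>

lemma mem_circ_arc_grid_iff:
  assumes Q: "0 < Q"
  shows "of_int (x mod Q) / of_int Q \<in> circ_arc (of_int l / of_int Q) (of_int u / of_int Q)
    \<longleftrightarrow> (\<exists>z. l \<le> x + z * Q \<and> x + z * Q \<le> u)"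
proof
  assume "of_int (x mod Q) / of_int Q \<in> circ_arc (of_int l / of_int Q) (of_int u / of_int Q)"
  then obtain y :: real where y: "of_int l / of_int Q \<le> y" "y \<le> of_int u / of_int Q"
      "frac y = of_int (x mod Q) / of_int Q"
    by (auto simp: circ_arc_def)
  define z where "z = \<lfloor>y\<rfloor> - x div Q"
  have "y = of_int (x mod Q) / of_int Q + of_int \<lfloor>y\<rfloor>" using y(3) by (simp add: frac_def)
  then have "y * of_int Q = of_int (x mod Q + \<lfloor>y\<rfloor> * Q)" using Q by (simp add: field_simps)
  also have "x mod Q + \<lfloor>y\<rfloor> * Q = x + z * Q"
    by (simp add: z_def left_diff_distrib minus_div_mult_eq_mod[symmetric])
  finally have "y * of_int Q = of_int (x + z * Q)" .
  then have "real_of_int l \<le> of_int (x + z * Q)" "of_int (x + z * Q) \<le> real_of_int u"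
    using y(1,2) Q by (simp_all add: field_simps)
  then show "\<exists>z. l \<le> x + z * Q \<and> x + z * Q \<le> u" by (auto simp only: of_int_le_iff)
next
  assume "\<exists>z. l \<le> x + z * Q \<and> x + z * Q \<le> u"
  then obtain z where z: "l \<le> x + z * Q" "x + z * Q \<le> u" by blast
  have z': "real_of_int l \<le> of_int (x + z * Q)" "of_int (x + z * Q) \<le> real_of_int u"
    using z by (simp_all only: of_int_le_iff)
  define y where "y = of_int (x + z * Q) / real_of_int Q"
  have "\<lfloor>y\<rfloor> = (x + z * Q) div Q" unfolding y_def by (rule floor_divide_of_int_eq)
  then have "\<lfloor>y\<rfloor> = x div Q + z" using Q by simp
  then have "frac y = of_int (x - x div Q * Q) / of_int Q"
    using Q by (simp add: frac_def y_def field_simps)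
  then have "frac y = of_int (x mod Q) / of_int Q" by (simp add: minus_div_mult_eq_mod)
  moreover have "y \<in> {of_int l / of_int Q..of_int u / of_int Q}"
    using z' Q unfolding y_def atLeastAtMost_iff by (intro conjI divide_right_mono) simp_all
  ultimately show "of_int (x mod Q) / of_int Q \<in> circ_arc (of_int l / of_int Q) (of_int u / of_int Q)"
    unfolding circ_arc_def by (metis image_eqI)
qed

text \<open>
  Among the shifts \<open>x + z Q\<close> that are at least \<open>l\<close>, the least one is \<open>l + (x - l) mod Q\<close>; so it
  suffices to look at this one.
\<close>

lemma ex_shift_iff_mod_le:
  fixes x l u Q :: int
  assumes Q: "0 < Q"
  shows "(\<exists>z. l \<le> x + z * Q \<and> x + z * Q \<le> u) \<longleftrightarrow> (x - l) mod Q \<le> u - l"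
proof
  assume "\<exists>z. l \<le> x + z * Q \<and> x + z * Q \<le> u"
  then obtain z where z: "l \<le> x + z * Q" "x + z * Q \<le> u" by blast
  have "(x - l) mod Q = (x - l + z * Q) mod Q" by simp
  also have "\<dots> \<le> x - l + z * Q" using z by (intro zmod_le_nonneg_dividend) simp
  finally show "(x - l) mod Q \<le> u - l" using z by simp
next
  assume le: "(x - l) mod Q \<le> u - l"
  have "x + (- ((x - l) div Q)) * Q = l + (x - l) mod Q"
    using div_mult_mod_eq[of "x - l" Q] by (simp add: algebra_simps)
  then have "l \<le> x + (- ((x - l) div Q)) * Q \<and> x + (- ((x - l) div Q)) * Q \<le> u"
    using le pos_mod_sign[OF Q, of "x - l"] by simp
  then show "\<exists>z. l \<le> x + z * Q \<and> x + z * Q \<le> u" by blast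
qed

lemma is_nearest_int_le_half:
  assumes "is_nearest_int n x"
  shows "\<bar>x - of_int n\<bar> \<le> 1 / 2"
  using assms of_int_round_abs_le[of x] unfolding is_nearest_int_def
  by (metis abs_minus_commute order_trans)

lemma nearest_grid_point:
  assumes "0 < Q" "is_nearest_int n (of_int Q * x)"
  shows "\<bar>x - of_int n / of_int Q\<bar> \<le> 1 / (2 * of_int Q)"
proof -
  have "x - of_int n / of_int Q = (of_int Q * x - of_int n) / of_int Q"
    using assms(1) by (simp add: field_simps)
  also have "\<bar>\<dots>\<bar> \<le> 1 / 2 / of_int Q"
    using divide_right_mono[OF is_nearest_int_le_half[OF assms(2)], of "of_int Q"] assms(1)
    by (simp add: abs_divide)
  finally show ?thesis by simp
qed

section \<open>Solutions and candidates\<close>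

text \<open>
  The integer \<open>z\<close> collects the two integer parts that were dropped in \<open>frac\<close> and the exponent of \<open>b\<close>;
  what remains is \<open>m \<alpha> - k - log\<^sub>b (M + 1)\<close> with \<open>m = M + j\<close>, which lies between
  \<open>log\<^sub>b m - log\<^sub>b (M + 1) \<ge> 0\<close> and \<open>log\<^sub>b (m + 1) - log\<^sub>b (M + 1)\<close>.
\<close>

lemma sol_set_rotation:
  fixes b M j H :: nat and c \<alpha> :: real
  defines "\<alpha> \<equiv> log b c"
  assumes b: "2 \<le> b" and c: "2 \<le> c" and j: "1 \<le> j" "j \<le> H" and sol: "M + j \<in> sol_set c b"
  shows "\<exists>z::int. 0 \<le> frac (M * \<alpha> - log b (M + 1)) + j * frac \<alpha> + z \<and>
    frac (M * \<alpha> - log b (M + 1)) + j * frac \<alpha> + z \<le> log b ((real M + real H + 1) / (real M + 1))"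
proof -
  from sol obtain k :: nat where k: "real (M + j) * real b ^ k \<le> c ^ (M + j)"
      "c ^ (M + j) < real (M + j + 1) * real b ^ k"
    by (auto simp: sol_set_def)
  have b1: "1 < real b" and b0: "0 < real b" using b by auto
  have c0: "0 < c" using c by simp
  have pw: "log b (real b ^ k) = k" using b1 by (simp add: log_nat_power)
  have lc: "log b (c ^ (M + j)) = (M + j) * \<alpha>" using c0 by (simp add: log_nat_power \<alpha>_def)
  have "log b (real (M + j) * real b ^ k) \<le> log b (c ^ (M + j))"
    using k(1) b1 b0 j by (intro log_mono) auto
  then have lo: "log b (M + j) + k \<le> (M + j) * \<alpha>"
    using b1 j by (simp add: log_mult pw lc del: of_nat_add)
  have "log b (c ^ (M + j)) \<le> log b (real (M + j + 1) * real b ^ k)"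
    using k(2) b1 c0 by (intro log_mono) auto
  then have hi: "(M + j) * \<alpha> \<le> log b (M + j + 1) + k"
    using b1 by (simp add: log_mult pw lc del: of_nat_add)
  have "log b (M + 1) \<le> log b (M + j)" using j b1 by (intro log_mono) auto
  moreover have "log b (M + j + 1) \<le> log b (M + H + 1)" using j b1 by (intro log_mono) auto
  moreover have "log b ((real M + real H + 1) / (real M + 1)) = log b (M + H + 1) - log b (M + 1)"
    using b1 by (simp add: log_divide add_ac)
  moreover define z where "z = \<lfloor>M * \<alpha> - log b (M + 1)\<rfloor> + int j * \<lfloor>\<alpha>\<rfloor> - int k"
  have "frac (M * \<alpha> - log b (M + 1)) + j * frac \<alpha> + z = (M + j) * \<alpha> - k - log b (M + 1)"
    by (simp add: frac_def z_def algebra_simps)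
  ultimately show ?thesis using lo hi by (intro exI[of _ z]) linarith
qed

text \<open>
  The grid point of index \<open>j\<close> differs from \<open>\<theta> + j \<rho>\<close> by the rounding error of \<open>\<theta>\<close> plus \<open>j\<close> times that of
  \<open>\<rho>\<close>, hence by at most half of the margin \<open>(H + 1) / Q\<close> that was added to the arc on either side.
\<close>

lemma solution_is_candidate:
  fixes \<theta> \<rho> t :: real and z :: int
  assumes Q: "0 < Q" and j: "1 \<le> j" "j \<le> H"
    and B: "\<bar>\<theta> - of_int B / of_int Q\<bar> \<le> 1 / (2 * of_int Q)"
    and P: "\<bar>\<rho> - of_int P / of_int Q\<bar> \<le> 1 / (2 * of_int Q)"
    and round: "outward_rounding Q (- (real H + 1) / of_int Q) (t + (real H + 1) / of_int Q) l u"
    and z: "0 \<le> \<theta> + j * \<rho> + z" "\<theta> + j * \<rho> + z \<le> t"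
  shows "j \<in> candidates Q B P (circ_arc (of_int l / of_int Q) (of_int u / of_int Q)) H"
proof -
  have Q0: "0 < real_of_int Q" using Q by simp
  define x where "x = B + P * int j"
  define v where "v = \<theta> + j * \<rho> + z"
  have "\<bar>real j * (\<rho> - of_int P / of_int Q)\<bar> \<le> real j * (1 / (2 * of_int Q))"
    unfolding abs_mult using P by (intro mult_mono) auto
  moreover have "v - of_int (x + z * Q) / of_int Q = (\<theta> - of_int B / of_int Q) + real j * (\<rho> - of_int P / of_int Q)"
    using Q0 by (simp add: v_def x_def field_simps)
  moreover note abs_triangle_ineq[of "\<theta> - of_int B / of_int Q" "real j * (\<rho> - of_int P / of_int Q)"]
  ultimately have "\<bar>v - of_int (x + z * Q) / of_int Q\<bar> \<le> 1 / (2 * of_int Q) + real j * (1 / (2 * of_int Q))"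
    using B by simp
  also have "\<dots> = (1 + real j) / 2 / of_int Q" using Q0 by (simp add: field_simps)
  also have "\<dots> \<le> (real H + 1) / of_int Q" using Q0 j by (intro divide_right_mono) auto
  finally have near: "\<bar>v - of_int (x + z * Q) / of_int Q\<bar> \<le> (real H + 1) / of_int Q" .
  have "of_int l / of_int Q \<le> - ((real H + 1) / real_of_int Q)" "t + (real H + 1) / of_int Q \<le> of_int u / real_of_int Q"
    using round by (simp_all only: outward_rounding_def minus_divide_left)
  then have "of_int l / of_int Q \<le> of_int (x + z * Q) / real_of_int Q"
      "of_int (x + z * Q) / of_int Q \<le> of_int u / real_of_int Q"
    using near z unfolding v_def by linarith+
  then have "real_of_int l \<le> of_int (x + z * Q)" "of_int (x + z * Q) \<le> real_of_int u"
    using Q0 by (simp_all only: divide_le_cancel)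
  then have "l \<le> x + z * Q \<and> x + z * Q \<le> u" by (simp only: of_int_le_iff)
  then show ?thesis
    using j mem_circ_arc_grid_iff[OF Q, of x l u] by (auto simp: candidates_def x_def)
qed

lemma outward_rounding_width:
  assumes "0 < Q" "outward_rounding Q (- (real H + 1) / of_int Q) (t + (real H + 1) / of_int Q) l u"
  shows "of_int (u - l) < of_int Q * t + 2 * real H + 8"
proof -
  have Q: "0 < real_of_int Q" using assms(1) by simp
  have "of_int (u - l) / of_int Q < t + (2 * real H + 8) / of_int Q"
    using assms(2) by (simp add: outward_rounding_def diff_divide_distrib add_divide_distrib)
  also have "\<dots> = (of_int Q * t + 2 * real H + 8) / of_int Q" using Q by (simp add: field_simps)
  finally show ?thesis using Q by (simp only: divide_less_cancel)
qed

text \<open>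
  Subtracting the grid points of two candidates brings a multiple \<open>h \<rho>\<close> with \<open>1 \<le> h < q'\<close> so close to
  an integer that \<open>Q d < Q t + 5 H / 2 + 8\<close>: the arc contributes \<open>Q t + 2 H + 8\<close>, the rounding of \<open>\<rho>\<close>
  at most \<open>H / 2\<close>. As \<open>t \<le> d / 2\<close>, this yields \<open>Q d < 5 H + 16\<close>, whereas the choice of \<open>Q\<close> gives
  \<open>Q d > 16 (H + 3)\<close>.
\<close>

lemma candidates_at_most_one:
  fixes \<rho> t d :: real and n :: nat
  defines "q \<equiv> cf_denom \<rho> n" and "q' \<equiv> cf_denom \<rho> (Suc n)"
  assumes irr: "\<rho> \<notin> \<rat>" and lt: "q < q'" and d: "d = int_dist (of_int q * \<rho>)"
    and H: "int H \<le> q'" and t: "t \<le> d / 2" and Q: "16 * (int H + 3) * (q' + q) < Q" "0 < Q"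
    and P: "\<bar>\<rho> - of_int P / of_int Q\<bar> \<le> 1 / (2 * of_int Q)"
    and round: "outward_rounding Q (- (real H + 1) / of_int Q) (t + (real H + 1) / of_int Q) l u"
  shows "card (candidates Q B P (circ_arc (of_int l / of_int Q) (of_int u / of_int Q)) H) \<le> 1"
proof -
  let ?R = "candidates Q B P (circ_arc (of_int l / of_int Q) (of_int u / of_int Q)) H"
  have Q0: "0 < real_of_int Q" using Q by simp
  have sd: "1 \<le> of_int (q' + q) * d"
    unfolding d q_def q'_def using lt by (intro int_dist_convergent_ge irr) (simp add: q_def q'_def)
  have "0 \<le> d" by (simp add: d int_dist_def)
  moreover have "d \<noteq> 0" using sd by auto
  ultimately have d0: "0 < d" by simp
  have "16 * (real H + 3) * 1 \<le> 16 * (real H + 3) * (of_int (q' + q) * d)"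
    using sd by (intro mult_left_mono) auto
  also have "\<dots> = of_int (16 * (int H + 3) * (q' + q)) * d" by simp
  also have "\<dots> < of_int Q * d" using Q d0 by (intro mult_strict_right_mono) (simp_all only: of_int_less_iff)
  finally have Qd: "16 * (real H + 3) < of_int Q * d" by simp
  have no_pair: False if i: "i \<in> ?R" and j: "j \<in> ?R" and less: "i < j" for i j
  proof -
    from i obtain z where z: "l \<le> B + P * int i + z * Q" "B + P * int i + z * Q \<le> u"
      using mem_circ_arc_grid_iff[OF Q(2)] by (auto simp: candidates_def)
    from j obtain w where w: "l \<le> B + P * int j + w * Q" "B + P * int j + w * Q \<le> u"
      using mem_circ_arc_grid_iff[OF Q(2)] by (auto simp: candidates_def)
    define h where "h = int j - int i"
    have bounds: "1 \<le> i" "j \<le> H" using i j by (auto simp: candidates_def)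
    have h: "1 \<le> h" "h < q'" "h \<le> int H" using less bounds H by (auto simp: h_def)
    have hH: "real_of_int h \<le> real H" using h(3) by linarith
    have "d \<le> \<bar>of_int h * \<rho> - of_int (z - w)\<bar>"
      unfolding d q_def using h by (intro int_dist_convergent_le irr) (auto simp: q'_def)
    also have "of_int h * \<rho> - of_int (z - w)
        = of_int h * (\<rho> - of_int P / of_int Q) + of_int (P * h + (w - z) * Q) / of_int Q"
      using Q0 by (simp add: field_simps)
    also have "\<bar>\<dots>\<bar> \<le> of_int h * (1 / (2 * of_int Q)) + of_int (u - l) / of_int Q"
    proof -
      have "\<bar>of_int h * (\<rho> - of_int P / of_int Q)\<bar> \<le> of_int h * (1 / (2 * of_int Q))"
        unfolding abs_mult using P h by (intro mult_mono) auto
      moreover have "\<bar>P * h + (w - z) * Q\<bar> \<le> u - l"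
        using z w by (auto simp: h_def algebra_simps abs_le_iff)
      then have "\<bar>real_of_int (P * h + (w - z) * Q)\<bar> \<le> of_int (u - l)"
        by (simp only: of_int_abs[symmetric] of_int_le_iff)
      then have "\<bar>of_int (P * h + (w - z) * Q) / real_of_int Q\<bar> \<le> of_int (u - l) / of_int Q"
        unfolding abs_divide using Q0 by (simp only: abs_of_pos divide_right_mono less_imp_le)
      ultimately show ?thesis by (rule order_trans[OF abs_triangle_ineq add_mono])
    qed
    also have "\<dots> = (of_int h / 2 + of_int (u - l)) / of_int Q"
      using Q0 by (simp add: field_simps)
    finally have "d * of_int Q \<le> of_int h / 2 + of_int (u - l)"
      using Q0 by (simp only: pos_le_divide_eq)
    also have "\<dots> < real H / 2 + (of_int Q * t + 2 * real H + 8)"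
      using outward_rounding_width[OF Q(2) round] hH by simp
    also have "of_int Q * t \<le> of_int Q * (d / 2)" using t Q0 by (intro mult_left_mono) auto
    finally have "of_int Q * d < 5 * real H + 16" by (simp add: algebra_simps)
    then show False using Qd by simp
  qed
  have "finite ?R" by (rule finite_subset[of _ "{..H}"]) (auto simp: candidates_def)
  moreover have "i = j" if "i \<in> ?R" "j \<in> ?R" for i j
    using no_pair[of i j] no_pair[of j i] that by (metis linorder_neqE_nat)
  ultimately show ?thesis by (simp add: card_le_Suc0_iff_eq)
qed

lemma ex_bit_length:
  fixes x :: real
  assumes "1 \<le> x"
  shows "\<exists>L::nat. x < 2 ^ L \<and> L \<le> log 2 x + 1"
proof (intro exI conjI)
  let ?f = "\<lfloor>log 2 x\<rfloor>"
  have f: "0 \<le> ?f" using assms by simp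
  have "x = 2 powr log 2 x" using assms by simp
  also have "\<dots> < 2 powr of_int (?f + 1)" by (intro powr_less_mono) (linarith, simp)
  also have "\<dots> = 2 powr real (nat ?f + 1)" using f by (simp add: add.commute)
  also have "\<dots> = 2 ^ (nat ?f + 1)" by (rule powr_realpow) simp
  finally show "x < 2 ^ (nat ?f + 1)" .
  show "real (nat ?f + 1) \<le> log 2 x + 1" using f by simp
qed

text \<open>
  The program returns the least hit, which is the only one if there is at most one. The constant
  arises as \<open>100 * 3 * 3\<close>: the program takes at most \<open>100 (L + 1) (i + 1)\<close> steps for bit lengths \<open>L\<close> of
  \<open>Q\<close> and \<open>i\<close> of \<open>H\<close>, and \<open>L + 1\<close> and \<open>i + 1\<close> are at most three times the binary logarithms of
  \<open>Q \<ge> 2\<close> and \<open>H + 1 \<ge> 2\<close>.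
\<close>

lemma report_prog_reports:
  fixes s :: state and H :: nat
  defines "R \<equiv> candidates (s ''Q'') (s ''B'') (s ''P'')
    (circ_arc (of_int (s ''l'') / of_int (s ''Q'')) (of_int (s ''u'') / of_int (s ''Q''))) H"
  assumes P: "0 \<le> s ''P''" and Q: "2 \<le> s ''Q''" and lu: "s ''l'' \<le> s ''u''" "s ''u'' - s ''l'' < s ''Q''"
    and H: "1 \<le> H" "s ''H'' = int H" and card: "card R \<le> 1"
  shows "\<exists>n s'. exec report_prog s n s' \<and>
    R = (if s' ''out'' = 0 then {} else {nat (s' ''out'')}) \<and>
    real n \<le> 900 / (ln 2)\<^sup>2 * (ln (real H + 1) * ln (of_int (s ''Q'')))"
proof -
  let ?Q = "s ''Q''"
  have Q0: "0 < ?Q" using Q by simp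
  obtain L where L: "of_int ?Q < (2::real) ^ L" "L \<le> log 2 (of_int ?Q) + 1"
    using ex_bit_length[of "of_int ?Q"] Q by auto
  obtain i where i: "real H < (2::real) ^ i" "i \<le> log 2 (real H) + 1"
    using ex_bit_length[of "real H"] H by auto
  have "real_of_int ?Q < real_of_int (2 ^ L)" "real_of_int (int H) < real_of_int (2 ^ i)"
    using L(1) i(1) by simp_all
  then have pows: "?Q < 2 ^ L" "int H < 2 ^ i" by (simp_all only: of_int_less_iff)
  have "searchable s L" using P Q0 lu pows by (simp add: searchable_def)
  from runs_report_prog[OF this, of i, unfolded H(2)] obtain n s' where run: "exec report_prog s n s'"
      "n \<le> 100 * (L + 1) * (i + 1)"
    and out: "if hits s (int H) = {} then s' ''out'' = 0
       else 1 \<le> s' ''out'' \<and> s' ''out'' \<le> int H \<and>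
         hits s (s' ''out'' - 1) = {} \<and> hits s (s' ''out'') \<noteq> {}"
    using H(1) pows by (auto simp: runs_def)
  have mem: "j \<in> R \<longleftrightarrow> int j \<in> hits s (int H)" for j
    unfolding R_def candidates_def hits_def mem_Collect_eq
      mem_circ_arc_grid_iff[OF Q0] ex_shift_iff_mod_le[OF Q0] by auto
  have R: "R = (if s' ''out'' = 0 then {} else {nat (s' ''out'')})"
  proof (cases "hits s (int H) = {}")
    case True
    then show ?thesis using out mem by auto
  next
    case False
    then have o: "1 \<le> s' ''out''" "s' ''out'' \<le> int H"
        "hits s (s' ''out'' - 1) = {}" "hits s (s' ''out'') \<noteq> {}"
      using out by auto
    \<comment> \<open>There is a hit up to \<open>out\<close> but none before it, so \<open>out\<close> itself is a hit.\<close>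
    then obtain j where j: "j \<in> hits s (s' ''out'')" "j \<notin> hits s (s' ''out'' - 1)" by auto
    then have "j = s' ''out''" by (auto simp: hits_def)
    then have "nat (s' ''out'') \<in> R" using j(1) o unfolding mem by (simp add: hits_def)
    moreover have "finite R" unfolding R_def
      by (rule finite_subset[of _ "{..H}"]) (auto simp: candidates_def)
    ultimately have "R = {nat (s' ''out'')}"
      using card by (auto simp: card_le_Suc0_iff_eq)
    then show ?thesis using o by simp
  qed
  have "1 \<le> log 2 (real_of_int ?Q)" "1 \<le> log 2 (real H + 1)" using Q H by simp_all
  moreover have "log 2 (real H) \<le> log 2 (real H + 1)" using H by simp
  ultimately have "real (L + 1) \<le> 3 * log 2 (of_int ?Q)" "real (i + 1) \<le> 3 * log 2 (real H + 1)"
    using L(2) i(2) by linarith+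
  then have "real (L + 1) * real (i + 1) \<le> (3 * log 2 (of_int ?Q)) * (3 * log 2 (real H + 1))"
    by (intro mult_mono) auto
  also have "\<dots> = 9 / (ln 2)\<^sup>2 * (ln (real H + 1) * ln (of_int ?Q))"
    by (simp add: log_def power2_eq_square)
  finally have "100 * (real (L + 1) * real (i + 1)) \<le> 900 / (ln 2)\<^sup>2 * (ln (real H + 1) * ln (of_int ?Q))"
    by simp
  moreover have "real n \<le> real (100 * (L + 1) * (i + 1))" using run(2) by (rule of_nat_mono)
  then have "real n \<le> 100 * (real (L + 1) * real (i + 1))" by (simp only: of_nat_mult of_nat_numeral mult.assoc)
  ultimately have "real n \<le> 900 / (ln 2)\<^sup>2 * (ln (real H + 1) * ln (of_int ?Q))" by linarith
  with run(1) R show ?thesis by blast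
qed

lemma window_small:
  fixes b M H :: nat and d q :: real
  assumes b: "2 \<le> b" and d: "0 < d" and H: "real H \<le> q"
    and M: "q / (real b powr (d / 2) - 1) - 1 \<le> real M"
  shows "log b ((real M + real H + 1) / (real M + 1)) \<le> d / 2"
proof -
  have b1: "1 < real b" using b by simp
  have "real b powr 0 < real b powr (d / 2)" using b1 d by (intro powr_less_mono) auto
  then have pos: "0 < real b powr (d / 2) - 1" using b by simp
  have "q \<le> (real M + 1) * (real b powr (d / 2) - 1)" using M pos by (simp add: field_simps)
  then have "(real M + real H + 1) / (real M + 1) \<le> real b powr (d / 2)"
    using H by (simp add: field_simps)
  moreover have "0 < (real M + real H + 1) / (real M + 1)" by simp
  ultimately show ?thesis using log_le_iff[OF b1] by blast
qed

theorem theorem6p3: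
  shows "\<exists>K::real. \<forall>(b::nat) (c::real) (\<alpha>::real) (\<rho>::real) (k::nat) (d::real) (M::nat) (H::nat) (t::real) (\<theta>::real).
    2 \<le> b \<and> 2 \<le> c \<and> \<alpha> = log (real b) c \<and> \<rho> = frac \<alpha> \<and> \<rho> \<notin> \<rat> \<and>
    1 \<le> k \<and> cf_denom \<rho> (k - 1) < cf_denom \<rho> k \<and> 2 \<le> cf_denom \<rho> k \<and>
    d = int_dist (of_int (cf_denom \<rho> (k - 1)) * \<rho>) \<and>
    1 \<le> M \<and> 1 \<le> H \<and>
    t = log (real b) ((real M + real H + 1) / (real M + 1)) \<and>
    \<theta> = frac (real M * \<alpha> - log (real b) (real M + 1)) \<longrightarrow>
    (int H \<le> cf_denom \<rho> k \<and>
     real M \<ge> of_int (cf_denom \<rho> k) / (real b powr (d / 2) - 1) - 1 \<longrightarrow> t \<le> d / 2) \<and>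
    (int H \<le> cf_denom \<rho> k \<and> t \<le> d / 2 \<longrightarrow>
     (\<forall>(Q::int) (B::int) (P::int) (l::int) (u::int) (J::real set) (R::nat set).
        Q > 16 * (int H + 3) * (cf_denom \<rho> k + cf_denom \<rho> (k - 1)) \<and>
        is_nearest_int B (of_int Q * \<theta>) \<and> is_nearest_int P (of_int Q * \<rho>) \<and>
        outward_rounding Q (- (real H + 1) / of_int Q) (t + (real H + 1) / of_int Q) l u \<and>
        J = circ_arc (of_int l / of_int Q) (of_int u / of_int Q) \<and>
        R = candidates Q B P J H \<longrightarrow>
        circ_dist \<theta> (of_int B / of_int Q) \<le> 1 / (2 * of_int Q) \<and>
        \<bar>\<rho> - of_int P / of_int Q\<bar> \<le> 1 / (2 * of_int Q) \<and>
        (\<forall>j\<in>{1..H}. M + j \<in> sol_set c b \<longrightarrow> j \<in> R) \<and>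
        card R \<le> 1 \<and>
        (\<forall>s. s ''B'' = B \<and> s ''P'' = P \<and> s ''Q'' = Q \<and> s ''l'' = l \<and> s ''u'' = u \<and> s ''H'' = int H \<longrightarrow>
           (\<exists>n s'. exec report_prog s n s' \<and>
              R = (if s' ''out'' = 0 then {} else {nat (s' ''out'')}) \<and>
              real n \<le> K * (ln (real H + 1) * ln (of_int Q))))))"
proof (rule exI[of _ "900 / (ln 2)\<^sup>2"], intro allI impI, elim conjE, goal_cases)
  case (1 b c \<alpha> \<rho> k d M H t \<theta>)
  note b = 1(1) and c = 1(2) and \<alpha> = 1(3) and \<rho> = 1(4) and irr = 1(5) and k = 1(6) and lt = 1(7)
    and d = 1(9) and H = 1(11) and t = 1(12) and \<theta> = 1(13)
  obtain n where n: "k = Suc n" using k by (cases k) auto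
  let ?q = "cf_denom \<rho> (k - 1)" and ?q' = "cf_denom \<rho> k"
  have pos: "1 \<le> ?q" "1 \<le> ?q'" using cf_denom_pos[OF irr] by auto
  have sd: "1 \<le> of_int (?q' + ?q) * d"
    unfolding d n diff_Suc_1 using lt n by (intro int_dist_convergent_ge irr) simp
  have "0 \<le> d" by (simp add: d int_dist_def)
  moreover have "d \<noteq> 0" using sd by auto
  ultimately have d0: "0 < d" by simp
  have d_half: "d \<le> 1 / 2"
    unfolding d int_dist_def using of_int_round_abs_le[of "of_int ?q * \<rho>"] by (simp add: abs_minus_commute)
  have t0: "0 \<le> t" using b H unfolding t by (simp add: zero_le_log_cancel_iff)
  have small_window: "t \<le> d / 2"
    if "int H \<le> ?q'" "real M \<ge> of_int ?q' / (real b powr (d / 2) - 1) - 1"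
  proof -
    have "real H \<le> of_int ?q'" using that(1) by linarith
    then show ?thesis unfolding t using that(2) b d0 by (intro window_small) auto
  qed
  have main: "circ_dist \<theta> (of_int B / of_int Q) \<le> 1 / (2 * of_int Q) \<and>
        \<bar>\<rho> - of_int P / of_int Q\<bar> \<le> 1 / (2 * of_int Q) \<and>
        (\<forall>j\<in>{1..H}. M + j \<in> sol_set c b \<longrightarrow> j \<in> R) \<and>
        card R \<le> 1 \<and>
        (\<forall>s. s ''B'' = B \<and> s ''P'' = P \<and> s ''Q'' = Q \<and> s ''l'' = l \<and> s ''u'' = u \<and> s ''H'' = int H \<longrightarrow>
           (\<exists>n s'. exec report_prog s n s' \<and>
              R = (if s' ''out'' = 0 then {} else {nat (s' ''out'')}) \<and>
              real n \<le> 900 / (ln 2)\<^sup>2 * (ln (real H + 1) * ln (of_int Q))))"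
    if Hq: "int H \<le> ?q'" and td: "t \<le> d / 2" and Q: "Q > 16 * (int H + 3) * (?q' + ?q)"
      and B: "is_nearest_int B (of_int Q * \<theta>)" and P: "is_nearest_int P (of_int Q * \<rho>)"
      and round: "outward_rounding Q (- (real H + 1) / of_int Q) (t + (real H + 1) / of_int Q) l u"
      and J: "J = circ_arc (of_int l / of_int Q) (of_int u / of_int Q)"
      and R: "R = candidates Q B P J H"
    for Q B P l u :: int and J :: "real set" and R :: "nat set"
  proof -
    have "16 * (int H + 3) * 2 \<le> 16 * (int H + 3) * (?q' + ?q)"
      using pos by (intro mult_left_mono) auto
    then have Qbig: "32 * (int H + 3) < Q" using Q by simp
    then have Q0: "0 < Q" "0 < real_of_int Q" by auto
    have near\<theta>: "\<bar>\<theta> - of_int B / of_int Q\<bar> \<le> 1 / (2 * of_int Q)"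
      by (rule nearest_grid_point[OF Q0(1) B])
    have near\<rho>: "\<bar>\<rho> - of_int P / of_int Q\<bar> \<le> 1 / (2 * of_int Q)"
      by (rule nearest_grid_point[OF Q0(1) P])
    have circ: "circ_dist \<theta> (of_int B / of_int Q) \<le> 1 / (2 * of_int Q)"
      using near\<theta> int_dist_le[of "\<theta> - of_int B / of_int Q" 0] by (simp add: circ_dist_def)
    have sols: "j \<in> R" if range: "j \<in> {1..H}" and sol: "M + j \<in> sol_set c b" for j
    proof -
      have j: "1 \<le> j" "j \<le> H" using range by auto
      obtain z :: int where "0 \<le> \<theta> + j * \<rho> + z" "\<theta> + j * \<rho> + z \<le> t"
        using sol_set_rotation[OF b c j sol] unfolding \<theta> \<rho> t \<alpha> by (auto simp: add.commute)
      then show ?thesis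
        unfolding R J by (rule solution_is_candidate[OF Q0(1) j near\<theta> near\<rho> round])
    qed
    have card: "card R \<le> 1"
      unfolding R J using lt d Hq td Q
      by (intro candidates_at_most_one[OF irr, of n d H t Q P l u B] Q0 near\<rho> round) (simp_all add: n)
    have P0: "0 \<le> P"
    proof (rule ccontr)
      assume "\<not> 0 \<le> P"
      moreover have "0 \<le> of_int Q * \<rho>" using Q0 by (simp add: \<rho>)
      ultimately have "real_of_int 1 \<le> \<bar>of_int Q * \<rho> - of_int P\<bar>" by linarith
      then show False using is_nearest_int_le_half[OF P] by simp
    qed
    \<comment> \<open>Counting by floor sums needs \<open>0 \<le> u - l < Q\<close>: the arc is not empty and shorter than the circle.\<close>
    have "of_int l / of_int Q \<le> of_int u / real_of_int Q"
    proof -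
      have "- (real H + 1) / of_int Q \<le> t + (real H + 1) / of_int Q"
        using t0 Q0 by (simp add: field_simps)
      then show ?thesis using round unfolding outward_rounding_def by linarith
    qed
    then have lu: "l \<le> u" using Q0 by (simp add: divide_le_cancel)
    have "real_of_int Q * t \<le> of_int Q * (1 / 4)" using td d_half Q0 by (intro mult_left_mono) auto
    moreover have "real_of_int (32 * (int H + 3)) < of_int Q" using Qbig by (simp only: of_int_less_iff)
    then have H_small: "32 * real H + 96 < of_int Q" by simp
    moreover have "0 \<le> real H" by simp
    ultimately have "real_of_int (u - l) < of_int Q"
      using outward_rounding_width[OF Q0(1) round] H_small by linarith
    then have width: "u - l < Q" by (simp only: of_int_less_iff)
    have "\<exists>n s'. exec report_prog s n s' \<and>
        R = (if s' ''out'' = 0 then {} else {nat (s' ''out'')}) \<and>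
        real n \<le> 900 / (ln 2)\<^sup>2 * (ln (real H + 1) * ln (of_int Q))"
      if s: "s ''B'' = B" "s ''P'' = P" "s ''Q'' = Q" "s ''l'' = l" "s ''u'' = u" "s ''H'' = int H" for s
      using report_prog_reports[of s H] P0 Qbig lu width H card unfolding s R J by simp
    then show ?thesis using circ near\<rho> sols card by blast
  qed
  show ?case
    using small_window main by blast
qed

end
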